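(* Let $Z=T_{\rm P}+\frac{\tau}{2}+NT_{\rm D}$ be the session length of CRA-1 and $\beta_1=\lambda Z$, and let the number $K$ of active users per session satisfy $\Pr(K=k)=\frac{\beta_1^k}{k!}e^{-\beta_1}$. Assume that multiuser detection fails if $K\ge N$. Then the average number of successfully recovered packets per session is $$\bar K_1=\sum_{k=1}^{N-1}\bar D_1(k)\Pr(K=k)=(1-P_{\rm MD})\,\beta_1e^{-\beta_1}\sum_{k=0}^{N-2}\frac{\left(\beta_1\left(1-\frac1L\right)\right)^k}{k!}=(1-P_{\rm MD})\,\beta_1e^{-\beta_1}\,\frac{\Gamma\!\left(N-1,\beta_1\left(1-\frac1L\right)\right)}{(N-1)!},$$ where $\Gamma(n,x)=\int_x^\infty t^{n-1}e^{-t}\,dt$ is the upper incomplete gamma function. The throughput of CRA-1 (the ratio of the average number of successfully transmitted packets to the session length) is $$\eta_1=\frac{\bar K_1}{Z}=\lambda\,(1-P_{\rm MD})\,e^{-\beta_1}\,\frac{\Gamma\!\left(N-1,\beta_1\left(1-\frac1L\right)\right)}{(N-1)!}.$$ Moreover, if $V$ is a Poisson random variable with mean $\beta_1\left(1-\frac1L\right)$, then $$\eta_1=\lambda\,(1-P_{\rm MD})\,e^{-\frac{\beta_1}{L}}\,\Pr(V\le N-2).$$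
   Context: In the random access scheme CRA-1, each of $K$ active users picks one of $L$ preambles of length $N$ at random, transmits it, and then transmits its data packet spread by that preamble (spreading gain $N$). $T_{\rm P}$ is the preamble duration, $\tau/2$ the feedback duration, $T_{\rm D}$ the (unspread) packet duration, and $\lambda$ the traffic intensity (number of users per unit time). $P_{\rm MD}$ is the constant missed-detection probability per transmitted preamble; packets of users whose preamble is missed or was also chosen by another user are lost. $\bar D_1(k)=(1-P_{\rm MD})L\alpha_1$ with $\alpha_1=\frac{k}{L}\left(1-\frac1L\right)^{k-1}$ is the mean number of correctly detected preambles chosen by exactly one user when $K=k$. When $K\ge N$, no packet is counted as recovered.
   Formalization: The two incomplete-gamma expressions are false as printed (N=2, L=2: the sum is 1 but Γ(1,x)/1! = e^{-x}); they are corrected by replacing e^{-β₁} with e^{-β₁/L} and (N-1)! with (N-2)!. N ≥ 2 is assumed. *)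

theory Defs
  imports "HOL-Probability.Probability"
begin

(* The Poisson law is given by its point probabilities rather than by poisson_pmf, because
   poisson_pmf requires a positive rate, and the mean \<mu> = \<beta> * (1 - 1/L) vanishes for L = 1. *)
definition has_poisson_law :: "'a measure \<Rightarrow> ('a \<Rightarrow> nat) \<Rightarrow> real \<Rightarrow> bool" where
  "has_poisson_law M X \<mu> \<longleftrightarrow>
     X \<in> measurable M (count_space UNIV) \<and>
     (\<forall>k. measure M {\<omega> \<in> space M. X \<omega> = k} = \<mu> ^ k / fact k * exp (- \<mu>))"

(* Only meant for n \<ge> 1; the subtraction n - 1 truncates at n = 0. *)
definition upper_incomplete_gamma :: "nat \<Rightarrow> real \<Rightarrow> real" where
  "upper_incomplete_gamma n x = (LBINT t:{x..}. t ^ (n - 1) * exp (- t))"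

definition session_length :: "real \<Rightarrow> real \<Rightarrow> nat \<Rightarrow> real \<Rightarrow> real" where
  "session_length T\<^sub>P \<tau> N T\<^sub>D = T\<^sub>P + \<tau> / 2 + real N * T\<^sub>D"

(* One session: K is the number of active users, C i is the preamble (in {..<L}) picked by user i,
   and D l says that the receiver detects preamble l.  Only the users i < K are active.
   Preambles are picked uniformly and independently.  Whatever the choices are, each transmitted
   preamble is missed with probability P_MD; nothing is assumed about the joint law of the
   detections of different preambles. *)
locale cra1_session = prob_space M
  for M :: "'a measure" +
  fixes L :: nat and P\<^sub>M\<^sub>D \<beta> :: real
    and K :: "'a \<Rightarrow> nat" and C :: "nat \<Rightarrow> 'a \<Rightarrow> nat" and D :: "nat \<Rightarrow> 'a \<Rightarrow> bool"
  assumes active_users: "has_poisson_law M K \<beta>"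
    and measurable_choice: "\<And>i. C i \<in> measurable M (count_space UNIV)"
    and measurable_detection: "\<And>l. D l \<in> measurable M (count_space UNIV)"
    and uniform_choice: "\<And>k c. (\<forall>i<k. c i < L) \<Longrightarrow>
          prob {\<omega> \<in> space M. K \<omega> = k \<and> (\<forall>i<k. C i \<omega> = c i)} =
          prob {\<omega> \<in> space M. K \<omega> = k} * (1 / real L) ^ k"
    and missed_detection: "\<And>k c l. (\<forall>i<k. c i < L) \<Longrightarrow> l \<in> c ` {..<k} \<Longrightarrow>
          prob {\<omega> \<in> space M. K \<omega> = k \<and> (\<forall>i<k. C i \<omega> = c i) \<and> \<not> D l \<omega>} =
          P\<^sub>M\<^sub>D * prob {\<omega> \<in> space M. K \<omega> = k \<and> (\<forall>i<k. C i \<omega> = c i)}"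

definition recovered_packets ::
  "nat \<Rightarrow> ('a \<Rightarrow> nat) \<Rightarrow> (nat \<Rightarrow> 'a \<Rightarrow> nat) \<Rightarrow> (nat \<Rightarrow> 'a \<Rightarrow> bool) \<Rightarrow> 'a \<Rightarrow> nat" where
  "recovered_packets N K C D \<omega> =
     (if K \<omega> \<ge> N then 0
      else card {i. i < K \<omega> \<and> (\<forall>j<K \<omega>. j \<noteq> i \<longrightarrow> C j \<omega> \<noteq> C i \<omega>) \<and> D (C i \<omega>) \<omega>})"

definition mean_recovered_packets ::
  "'a measure \<Rightarrow> nat \<Rightarrow> ('a \<Rightarrow> nat) \<Rightarrow> (nat \<Rightarrow> 'a \<Rightarrow> nat) \<Rightarrow> (nat \<Rightarrow> 'a \<Rightarrow> bool) \<Rightarrow> real" where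
  "mean_recovered_packets M N K C D = (LINT \<omega>|M. real (recovered_packets N K C D \<omega>))"

definition alpha1 :: "nat \<Rightarrow> nat \<Rightarrow> real" where
  "alpha1 L k = real k / real L * (1 - 1 / real L) ^ (k - 1)"

definition mean_detected_singletons :: "nat \<Rightarrow> real \<Rightarrow> nat \<Rightarrow> real" where
  "mean_detected_singletons L P\<^sub>M\<^sub>D k = (1 - P\<^sub>M\<^sub>D) * real L * alpha1 L k"

definition throughput :: "real \<Rightarrow> real \<Rightarrow> real" where
  "throughput mean_packets duration = mean_packets / duration"

(* Normalisation of the closed forms in the incomplete gamma function: for n \<ge> 1,
     upper_incomplete_gamma n x = fact (n - 1) * exp (- x) * (\<Sum>k<n. x ^ k / fact k).
   With n = N - 1 and x = \<beta> * (1 - 1/L) this gives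
     exp (- \<beta>) * (\<Sum>k\<le>N-2. x ^ k / fact k) = exp (- \<beta> / L) * upper_incomplete_gamma (N - 1) x / fact (N - 2).
   The source prints exp (- \<beta>) and fact (N - 1) on the right-hand side, which is a misprint
   (it also contradicts the source's own expression through a Poisson distribution function). *)

end

(* The mean number of recovered packets is the sum, over k < N and i < k, of the probability that
   K = k and user i's packet is recovered.  Conditionally on K = k the choice vectors are uniform on
   L^k points, of which L (L - 1)^(k - 1) isolate user i, and for each of them the detection
   probability is 1 - P_MD.  In the Poisson average the factor k cancels against k!, leaving a
   truncated exponential series; this series is both a Poisson distribution function and an
   incomplete gamma function. *)

theory Submission
  imports Defs
begin

section \<open>The incomplete gamma function of integer order\<close>

text \<open>Differentiating a truncated exponential series drops its top term. In the product rule
  the two series therefore cancel except for \<open>t ^ m / fact m\<close>, which yields an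
  antiderivative of the gamma integrand.\<close>

lemma deriv_exp_truncated:
  fixes t :: real
  shows "((\<lambda>t. - (fact m * exp (- t) * (\<Sum>k\<le>m. t ^ k / fact k)))
    has_real_derivative t ^ m * exp (- t)) (at t)"
proof -
  have S: "((\<lambda>t::real. \<Sum>k\<le>m. t ^ k / fact k) has_real_derivative (\<Sum>k<m. t ^ k / fact k)) (at t)"
  proof (induction m)
    case 0
    show ?case by simp
  next
    case (Suc m)
    have "((\<lambda>t::real. t ^ Suc m / fact (Suc m)) has_real_derivative
        (real (Suc m) * t ^ m) / fact (Suc m)) (at t)"
      by (rule derivative_eq_intros refl | simp)+
    moreover have "(real (Suc m) * t ^ m) / fact (Suc m) = t ^ m / fact m"
      by (simp add: divide_simps del: of_nat_Suc)
    ultimately have "((\<lambda>t::real. t ^ Suc m / fact (Suc m)) has_real_derivative t ^ m / fact m) (at t)"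
      by metis
    from DERIV_add[OF Suc this] show ?case by simp
  qed
  have "((\<lambda>t. - (fact m * exp (- t) * (\<Sum>k\<le>m. t ^ k / fact k))) has_real_derivative
      fact m * exp (- t) * ((\<Sum>k\<le>m. t ^ k / fact k) - (\<Sum>k<m. t ^ k / fact k))) (at t)"
    by (rule derivative_eq_intros S refl | simp add: algebra_simps)+
  moreover have "(\<Sum>k\<le>m. t ^ k / fact k) - (\<Sum>k<m. t ^ k / fact k) = t ^ m / fact m"
    by (simp add: lessThan_Suc_atMost[symmetric])
  ultimately show ?thesis by (simp add: mult.commute)
qed

text \<open>The antiderivative above vanishes at infinity, so the integral is minus its value at
  \<open>x\<close>. Since \<open>0 \<le> x\<close>, the integrand is nonnegative on the domain; the
  integral is computed as a nonnegative one first, and integrability follows from its finite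
  value.\<close>

lemma upper_incomplete_gamma_Suc:
  assumes "0 \<le> x"
  shows "upper_incomplete_gamma (Suc m) x = fact m * exp (- x) * (\<Sum>k\<le>m. x ^ k / fact k)"
proof -
  let ?f = "\<lambda>t::real. t ^ m * exp (- t)"
  let ?F = "\<lambda>t::real. - (fact m * exp (- t) * (\<Sum>k\<le>m. t ^ k / fact k))"
  have "((\<lambda>t::real. - (fact m * (\<Sum>k\<le>m. t ^ k / exp t / fact k))) \<longlongrightarrow> - (fact m * (\<Sum>k\<le>m. 0 / fact k))) at_top"
    by (intro tendsto_intros tendsto_power_div_exp_0) auto
  then have lim: "(?F \<longlongrightarrow> 0) at_top"
    by (simp add: exp_minus divide_simps sum_distrib_left sum_divide_distrib)
  have "(\<integral>\<^sup>+t. ennreal (?f t) * indicator {x..} t \<partial>lborel) = ennreal (0 - ?F x)"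
    by (rule nn_integral_FTC_atLeast[OF _ _ _ lim])
       (use assms in \<open>auto intro: deriv_exp_truncated\<close>)
  moreover have "ennreal (indicator {x..} t * ?f t) = ennreal (?f t) * indicator {x..} t" for t
    by (simp add: indicator_def)
  ultimately have "(\<integral>\<^sup>+t. ennreal (indicator {x..} t * ?f t) \<partial>lborel) =
      ennreal (fact m * exp (- x) * (\<Sum>k\<le>m. x ^ k / fact k))"
    by simp
  then have "has_bochner_integral lborel (\<lambda>t. indicator {x..} t * ?f t)
      (fact m * exp (- x) * (\<Sum>k\<le>m. x ^ k / fact k))"
    using assms
    by (intro has_bochner_integral_nn_integral)
       (auto simp: indicator_def intro!: mult_nonneg_nonneg sum_nonneg AE_I2)
  then show ?thesis
    by (simp add: upper_incomplete_gamma_def set_lebesgue_integral_def has_bochner_integral_integral_eq)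
qed

section \<open>Counting isolating choices, and the Poisson distribution function\<close>

text \<open>Classify by the value \<open>l\<close> at \<open>i\<close>: there are \<open>L\<close>
  possibilities, and each of the other \<open>k - 1\<close> coordinates then ranges freely over the
  \<open>L - 1\<close> values different from \<open>l\<close>.\<close>

lemma card_PiE_isolated:
  assumes "i < k"
  shows "card {c \<in> {..<k} \<rightarrow>\<^sub>E {..<L}. \<forall>j<k. j \<noteq> i \<longrightarrow> c j \<noteq> c i} = L * (L - 1) ^ (k - 1)"
proof -
  let ?B = "\<lambda>l. PiE {..<k} (\<lambda>j. if j = i then {l} else {..<L} - {l})"
  have "{c \<in> {..<k} \<rightarrow>\<^sub>E {..<L}. \<forall>j<k. j \<noteq> i \<longrightarrow> c j \<noteq> c i} = (\<Union>l\<in>{..<L}. ?B l)"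
  proof (intro set_eqI iffI)
    fix c assume "c \<in> {c \<in> {..<k} \<rightarrow>\<^sub>E {..<L}. \<forall>j<k. j \<noteq> i \<longrightarrow> c j \<noteq> c i}"
    then have "c i < L" "c \<in> ?B (c i)"
      using assms by (auto simp: PiE_iff)
    then show "c \<in> (\<Union>l\<in>{..<L}. ?B l)" by blast
  next
    fix c assume "c \<in> (\<Union>l\<in>{..<L}. ?B l)"
    then obtain l where l: "l < L" "c \<in> ?B l" by blast
    then have ext: "c \<in> extensional {..<k}"
      and val: "c j \<in> (if j = i then {l} else {..<L} - {l})" if "j < k" for j
      using that by (auto simp: PiE_iff)
    have ci: "c i = l" using val[OF assms] by simp
    have ne: "c j < L \<and> c j \<noteq> c i" if "j < k" "j \<noteq> i" for j
      using val[OF that(1)] that(2) ci by simp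
    have "c j < L" if "j < k" for j
      using ne[OF that] ci l(1) by (cases "j = i") auto
    with ne l(2) show "c \<in> {c \<in> {..<k} \<rightarrow>\<^sub>E {..<L}. \<forall>j<k. j \<noteq> i \<longrightarrow> c j \<noteq> c i}"
      by (simp add: PiE_iff)
  qed
  also have "card \<dots> = (\<Sum>l<L. card (?B l))"
  proof (rule card_UN_disjoint)
    \<comment> \<open>Every member of \<open>?B l\<close> takes the value \<open>l\<close> at
      \<open>i\<close>, so it determines \<open>l\<close>.\<close>
    show "\<forall>l\<in>{..<L}. \<forall>l'\<in>{..<L}. l \<noteq> l' \<longrightarrow> ?B l \<inter> ?B l' = {}"
      by (intro ballI impI Int_emptyI)
         (use assms in \<open>auto dest!: PiE_mem[where x = i]\<close>)
  qed (auto intro!: finite_PiE)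
  also have "\<dots> = (\<Sum>l<L. (L - 1) ^ (k - 1))"
  proof (rule sum.cong)
    fix l assume "l \<in> {..<L}"
    then have "card (?B l) = (\<Prod>j<k. if j = i then 1 else L - 1)"
      by (auto simp: card_PiE intro!: prod.cong)
    also have "\<dots> = (\<Prod>j\<in>{..<k} - {i}. if j = i then 1 else L - 1)"
      using assms by (subst prod.remove[of _ i]) auto
    also have "\<dots> = (\<Prod>j\<in>{..<k} - {i}. L - 1)"
      by (intro prod.cong) auto
    finally show "card (?B l) = (L - 1) ^ (k - 1)" using assms by simp
  qed simp
  finally show ?thesis by simp
qed

lemma (in prob_space) poisson_le:
  assumes "has_poisson_law M V \<mu>"
  shows "prob {\<omega> \<in> space M. V \<omega> \<le> n} = exp (- \<mu>) * (\<Sum>k\<le>n. \<mu> ^ k / fact k)"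
proof -
  have [measurable]: "V \<in> measurable M (count_space UNIV)"
    using assms by (simp add: has_poisson_law_def)
  have "{\<omega> \<in> space M. V \<omega> \<le> n} = (\<Union>k\<in>{..n}. {\<omega> \<in> space M. V \<omega> = k})" by auto
  also have "prob \<dots> = (\<Sum>k\<le>n. prob {\<omega> \<in> space M. V \<omega> = k})"
    by (rule finite_measure_finite_Union) (auto simp: disjoint_family_on_def)
  finally have "prob {\<omega> \<in> space M. V \<omega> \<le> n} = (\<Sum>k\<le>n. prob {\<omega> \<in> space M. V \<omega> = k})" .
  with assms show ?thesis
    by (simp add: has_poisson_law_def sum_distrib_left mult.commute)
qed

section \<open>Recovery probabilities within one session\<close>

context cra1_session
begin

lemma measurable_active_users: "K \<in> measurable M (count_space UNIV)"
  using active_users by (simp add: has_poisson_law_def)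

lemmas session_measurable [measurable] =
  measurable_active_users measurable_choice measurable_detection

definition configuration :: "nat \<Rightarrow> (nat \<Rightarrow> nat) \<Rightarrow> 'a set" where
  "configuration k c = {\<omega> \<in> space M. K \<omega> = k \<and> (\<forall>i<k. C i \<omega> = c i)}"

lemma configuration_sets [measurable]: "configuration k c \<in> sets M"
  unfolding configuration_def by measurable

text \<open>The locale does not state directly that choices lie below \<open>L\<close>. However, the
  \<open>L ^ k\<close> configurations are disjoint and each carries the fraction
  \<open>(1 / real L) ^ k\<close> of the probability of \<open>K = k\<close>, so together they fill
  that event up to a null set.\<close>

lemma prob_split_configurations:
  assumes L: "1 \<le> L" and B [measurable]: "B \<in> sets M"
    and sub: "B \<subseteq> {\<omega> \<in> space M. K \<omega> = k}"
  shows "prob B = (\<Sum>c\<in>{..<k} \<rightarrow>\<^sub>E {..<L}. prob (configuration k c \<inter> B))"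
proof -
  let ?E = "{..<k} \<rightarrow>\<^sub>E {..<L}"
  let ?U = "\<Union>c\<in>?E. configuration k c"
  let ?K = "{\<omega> \<in> space M. K \<omega> = k}"
  have fin: "finite ?E" by (simp add: finite_PiE)
  have disj: "disjoint_family_on (configuration k) ?E"
    unfolding disjoint_family_on_def
  proof (intro ballI impI Int_emptyI)
    fix c c' \<omega>
    assume "c \<in> ?E" "c' \<in> ?E" "c \<noteq> c'" "\<omega> \<in> configuration k c" "\<omega> \<in> configuration k c'"
    moreover then have "c i = c' i" if "i < k" for i
      using that by (auto simp: configuration_def)
    ultimately show False by (metis PiE_ext lessThan_iff)
  qed
  have U [measurable]: "?U \<in> sets M" using fin by (intro sets.finite_UN configuration_sets)
  have K [measurable]: "?K \<in> sets M" by measurable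
  have "prob ?U = (\<Sum>c\<in>?E. prob (configuration k c))"
    using fin disj by (intro finite_measure_finite_Union image_subsetI configuration_sets)
  also have "\<dots> = (\<Sum>c\<in>?E. prob ?K * (1 / real L) ^ k)"
    unfolding configuration_def by (intro sum.cong refl uniform_choice) auto
  also have "\<dots> = prob ?K"
    using L by (simp add: card_PiE power_divide)
  finally have "prob ?U = prob ?K" .
  moreover have "?U \<subseteq> ?K" by (auto simp: configuration_def)
  ultimately have "prob (?K - ?U) = 0"
    using finite_measure_Diff[OF K U] by simp
  \<comment> \<open>The part of \<open>B\<close> outside all configurations lies in the null set
    \<open>?K - ?U\<close>.\<close>
  then have "prob (B - ?U) = 0"
    using finite_measure_mono[OF Diff_mono[OF sub order_refl] sets.Diff[OF K U]]
      measure_nonneg[of M "B - ?U"] by linarith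
  moreover have "prob B = prob (?U \<inter> B) + prob (B - ?U)"
  proof -
    have "prob ((?U \<inter> B) \<union> (B - ?U)) = prob (?U \<inter> B) + prob (B - ?U)"
      using U B by (intro finite_measure_Union sets.Int sets.Diff) blast+
    moreover have "(?U \<inter> B) \<union> (B - ?U) = B" by blast
    ultimately show ?thesis by (simp only:)
  qed
  moreover have "?U \<inter> B = (\<Union>c\<in>?E. configuration k c \<inter> B)"
    by blast
  moreover have "prob (\<Union>c\<in>?E. configuration k c \<inter> B) = (\<Sum>c\<in>?E. prob (configuration k c \<inter> B))"
  proof (rule finite_measure_finite_Union[OF fin])
    show "disjoint_family_on (\<lambda>c. configuration k c \<inter> B) ?E"
      using disj unfolding disjoint_family_on_def by blast
  qed (intro image_subsetI sets.Int configuration_sets B)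
  ultimately show ?thesis by (simp only: add_0_right)
qed

definition recovered_event :: "nat \<Rightarrow> nat \<Rightarrow> 'a set" where
  "recovered_event k i =
    {\<omega> \<in> space M. K \<omega> = k \<and> (\<forall>j<k. j \<noteq> i \<longrightarrow> C j \<omega> \<noteq> C i \<omega>) \<and> D (C i \<omega>) \<omega>}"

lemma recovered_event_sets [measurable]: "recovered_event k i \<in> sets M"
proof -
  \<comment> \<open>The index of \<open>D\<close> is itself random; splitting by its value
    \<open>l\<close> leaves a countable union of events with a fixed index.\<close>
  have "recovered_event k i =
      (\<Union>l. {\<omega> \<in> space M. K \<omega> = k \<and> (\<forall>j<k. j \<noteq> i \<longrightarrow> C j \<omega> \<noteq> l) \<and> C i \<omega> = l \<and> D l \<omega>})"
    by (auto simp: recovered_event_def)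
  also have "\<dots> \<in> sets M"
    by measurable
  finally show ?thesis .
qed

text \<open>A fixed configuration decides whether user \<open>i\<close> is isolated. What remains
  random is the detection of the single preamble \<open>c i\<close>, whose probability the locale
  provides.\<close>

lemma prob_recovered_event:
  assumes L: "1 \<le> L" and i: "i < k"
  shows "prob (recovered_event k i) =
    (1 - P\<^sub>M\<^sub>D) * (1 - 1 / real L) ^ (k - 1) * prob {\<omega> \<in> space M. K \<omega> = k}"
proof -
  let ?E = "{..<k} \<rightarrow>\<^sub>E {..<L}"
  let ?I = "\<lambda>c. \<forall>j<k. j \<noteq> i \<longrightarrow> c j \<noteq> c i"
  let ?q = "(1 - P\<^sub>M\<^sub>D) * (prob {\<omega> \<in> space M. K \<omega> = k} * (1 / real L) ^ k)"
  have "prob (recovered_event k i) = (\<Sum>c\<in>?E. prob (configuration k c \<inter> recovered_event k i))"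
    by (rule prob_split_configurations[OF L recovered_event_sets]) (auto simp: recovered_event_def)
  also have "\<dots> = (\<Sum>c\<in>?E. if ?I c then ?q else 0)"
  proof (rule sum.cong)
    fix c assume c: "c \<in> ?E"
    then have cL: "\<forall>i<k. c i < L" by auto
    show "prob (configuration k c \<inter> recovered_event k i) = (if ?I c then ?q else 0)"
    proof (cases "?I c")
      case True
      \<comment> \<open>The locale speaks of misses, so detection is obtained as the complement of
        \<open>?m\<close> within the configuration. As \<open>i < k\<close>, the preamble
        \<open>c i\<close> is indeed a transmitted one.\<close>
      let ?m = "{\<omega> \<in> space M. K \<omega> = k \<and> (\<forall>i<k. C i \<omega> = c i) \<and> \<not> D (c i) \<omega>}"
      have "configuration k c \<inter> recovered_event k i = configuration k c - ?m"
        using True i by (auto simp: configuration_def recovered_event_def)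
      moreover have "prob (configuration k c - ?m) = prob (configuration k c) - prob ?m"
      proof (rule finite_measure_Diff)
        show "?m \<in> sets M" by measurable
        show "?m \<subseteq> configuration k c" by (auto simp: configuration_def)
      qed (rule configuration_sets)
      ultimately have "prob (configuration k c \<inter> recovered_event k i) = prob (configuration k c) - prob ?m"
        by (simp only:)
      also have "\<dots> = (1 - P\<^sub>M\<^sub>D) * prob (configuration k c)"
        using missed_detection[OF cL, of "c i"] i by (simp add: configuration_def algebra_simps)
      finally show ?thesis using True uniform_choice[OF cL] by (simp add: configuration_def)
    next
      case False
      then have "configuration k c \<inter> recovered_event k i = {}"
        using i by (auto simp: configuration_def recovered_event_def)
      then show ?thesis using False by (simp only: if_False) simp
    qed
  qed simp
  also have "\<dots> = real (card {c \<in> ?E. ?I c}) * ?q"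
    by (simp add: sum.If_cases finite_PiE Int_def)
  also have "\<dots> = real (L * (L - 1) ^ (k - 1)) * ?q"
    by (simp only: card_PiE_isolated[OF i])
  also have "\<dots> = (1 - P\<^sub>M\<^sub>D) * (real L * (real L - 1) ^ (k - 1) * (1 / real L) ^ k) *
      prob {\<omega> \<in> space M. K \<omega> = k}"
    using L by (simp add: of_nat_diff)
  \<comment> \<open>One of the \<open>k\<close> factors \<open>1 / real L\<close> cancels against
    \<open>real L\<close>; the other \<open>k - 1\<close> pair up with the factors
    \<open>real L - 1\<close>.\<close>
  also have "real L * (real L - 1) ^ (k - 1) * (1 / real L) ^ k = (1 - 1 / real L) ^ (k - 1)"
  proof -
    obtain k' where k': "k = Suc k'" using i by (cases k) auto
    have "1 - 1 / real L = (real L - 1) * (1 / real L)"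
      using L by (simp add: field_simps)
    then show ?thesis using L by (simp add: k' power_mult_distrib[symmetric])
  qed
  finally show ?thesis .
qed

text \<open>At a given outcome only the outer index \<open>k = K \<omega>\<close> contributes. The
  cutoff \<open>k < N\<close> encodes the failure of multiuser detection, and the indicators reduce
  the mean to probabilities by linearity.\<close>

lemma recovered_packets_eq_sum:
  assumes "\<omega> \<in> space M"
  shows "real (recovered_packets N K C D \<omega>) =
    (\<Sum>k<N. \<Sum>i<k. indicator (recovered_event k i) \<omega>)"
proof -
  let ?k = "K \<omega>"
  have zero: "(\<Sum>i<k. indicator (recovered_event k i) \<omega>) = (0::real)" if "k \<noteq> ?k" for k
    using that by (auto simp: recovered_event_def intro!: sum.neutral)
  show ?thesis
  proof (cases "?k < N")
    case True
    have "(\<Sum>k<N. \<Sum>i<k. indicator (recovered_event k i) \<omega>) =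
        (\<Sum>i<?k. indicator (recovered_event ?k i) \<omega> :: real)"
      using True zero by (subst sum.remove[of _ ?k]) auto
    also have "\<dots> = real (card {i \<in> {..<?k}. \<omega> \<in> recovered_event ?k i})"
      by (simp add: indicator_def sum.If_cases Int_def)
    also have "{i \<in> {..<?k}. \<omega> \<in> recovered_event ?k i} =
        {i. i < ?k \<and> (\<forall>j<?k. j \<noteq> i \<longrightarrow> C j \<omega> \<noteq> C i \<omega>) \<and> D (C i \<omega>) \<omega>}"
      using assms by (auto simp: recovered_event_def)
    finally show ?thesis using True by (simp add: recovered_packets_def)
  next
    case False
    then show ?thesis using zero by (auto simp: recovered_packets_def intro!: sum.neutral[symmetric])
  qed
qed

text \<open>All \<open>k\<close> users have the same recovery probability, so the inner sum is a
  factor \<open>k\<close>, which is the factor \<open>real L * (real k / real L)\<close> in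
  \<open>mean_detected_singletons\<close>.\<close>

lemma mean_recovered_packets_eq:
  assumes "1 \<le> L"
  shows "mean_recovered_packets M N K C D =
    (\<Sum>k<N. mean_detected_singletons L P\<^sub>M\<^sub>D k * prob {\<omega> \<in> space M. K \<omega> = k})"
proof -
  have "mean_recovered_packets M N K C D =
      (LINT \<omega>|M. (\<Sum>k<N. \<Sum>i<k. indicator (recovered_event k i) \<omega>))"
    unfolding mean_recovered_packets_def
    by (intro Bochner_Integration.integral_cong refl recovered_packets_eq_sum)
  also have "\<dots> = (\<Sum>k<N. \<Sum>i<k. prob (recovered_event k i))"
    by (subst Bochner_Integration.integral_sum; (intro sum.cong refl)?)
       (auto simp: Bochner_Integration.integral_sum less_top[symmetric])
  also have "\<dots> = (\<Sum>k<N. mean_detected_singletons L P\<^sub>M\<^sub>D k * prob {\<omega> \<in> space M. K \<omega> = k})"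
    using assms
    by (intro sum.cong refl)
       (simp add: prob_recovered_event mean_detected_singletons_def alpha1_def)
  finally show ?thesis .
qed

end

section \<open>Closed forms for the mean and the throughput\<close>

theorem mainTheorem4:
  fixes M :: "'a measure"
    and N L :: nat
    and T\<^sub>P \<tau> T\<^sub>D lam P\<^sub>M\<^sub>D Z \<beta>\<^sub>1 K\<^sub>1 \<eta>\<^sub>1 :: real
    and K :: "'a \<Rightarrow> nat" and C :: "nat \<Rightarrow> 'a \<Rightarrow> nat" and D :: "nat \<Rightarrow> 'a \<Rightarrow> bool"
  assumes "2 \<le> N" and "1 \<le> L"
    and "0 < T\<^sub>P" and "0 \<le> \<tau>" and "0 < T\<^sub>D" and "0 \<le> lam"
    and "0 \<le> P\<^sub>M\<^sub>D" and "P\<^sub>M\<^sub>D \<le> 1"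
    and Z: "Z = session_length T\<^sub>P \<tau> N T\<^sub>D"
    and beta: "\<beta>\<^sub>1 = lam * Z"
    and session: "cra1_session M L P\<^sub>M\<^sub>D \<beta>\<^sub>1 K C D"
    and K1: "K\<^sub>1 = mean_recovered_packets M N K C D"
    and eta1: "\<eta>\<^sub>1 = throughput K\<^sub>1 Z"
  shows "K\<^sub>1 = (\<Sum>k = 1..N - 1. mean_detected_singletons L P\<^sub>M\<^sub>D k * measure M {\<omega> \<in> space M. K \<omega> = k}) \<and>
    K\<^sub>1 = (1 - P\<^sub>M\<^sub>D) * \<beta>\<^sub>1 * exp (- \<beta>\<^sub>1)
           * (\<Sum>k = 0..N - 2. (\<beta>\<^sub>1 * (1 - 1 / real L)) ^ k / fact k) \<and>
    K\<^sub>1 = (1 - P\<^sub>M\<^sub>D) * \<beta>\<^sub>1 * exp (- \<beta>\<^sub>1 / real L)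
           * (upper_incomplete_gamma (N - 1) (\<beta>\<^sub>1 * (1 - 1 / real L)) / fact (N - 2)) \<and>
    \<eta>\<^sub>1 = lam * (1 - P\<^sub>M\<^sub>D) * exp (- \<beta>\<^sub>1 / real L)
           * (upper_incomplete_gamma (N - 1) (\<beta>\<^sub>1 * (1 - 1 / real L)) / fact (N - 2)) \<and>
    (\<forall>(M' :: 'b measure) V. prob_space M' \<longrightarrow> has_poisson_law M' V (\<beta>\<^sub>1 * (1 - 1 / real L)) \<longrightarrow>
           \<eta>\<^sub>1 = lam * (1 - P\<^sub>M\<^sub>D) * exp (- \<beta>\<^sub>1 / real L) * measure M' {\<omega> \<in> space M'. V \<omega> \<le> N - 2})"
proof -
  interpret cra1_session M L P\<^sub>M\<^sub>D \<beta>\<^sub>1 K C D by (rule session)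
  \<comment> \<open>With \<open>2 \<le> N\<close> no subtraction truncates: \<open>N - 1\<close> is
    \<open>Suc m\<close> and \<open>N - 2\<close> is \<open>m\<close>.\<close>
  obtain m where m: "N = Suc (Suc m)"
    using \<open>2 \<le> N\<close> by (metis add_2_eq_Suc le_Suc_ex)
  define x where "x = \<beta>\<^sub>1 * (1 - 1 / real L)"
  define S where "S = (\<Sum>k\<le>m. x ^ k / fact k)"
  have Zpos: "0 < Z"
    using assms(3-5) by (simp add: Z session_length_def add_pos_nonneg)
  have x: "0 \<le> x"
    using \<open>1 \<le> L\<close> \<open>0 \<le> lam\<close> Zpos by (simp add: x_def beta)
  have "K\<^sub>1 = (\<Sum>k\<le>Suc m. mean_detected_singletons L P\<^sub>M\<^sub>D k * prob {\<omega> \<in> space M. K \<omega> = k})"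
    by (simp only: K1 mean_recovered_packets_eq[OF \<open>1 \<le> L\<close>] m lessThan_Suc_atMost)
  \<comment> \<open>The term at 0 vanishes through the factor \<open>k\<close> in
    \<open>alpha1\<close>, so the index can be shifted.\<close>
  also have "\<dots> = (\<Sum>k\<le>m. mean_detected_singletons L P\<^sub>M\<^sub>D (Suc k) * prob {\<omega> \<in> space M. K \<omega> = Suc k})"
    by (simp add: sum.atMost_Suc_shift mean_detected_singletons_def alpha1_def del: sum.atMost_Suc)
  finally have 1: "K\<^sub>1 = (\<Sum>k\<le>m. mean_detected_singletons L P\<^sub>M\<^sub>D (Suc k) * prob {\<omega> \<in> space M. K \<omega> = Suc k})" .
  \<comment> \<open>The factor \<open>Suc k\<close> cancels against \<open>fact (Suc k)\<close>, one
    factor \<open>\<beta>\<^sub>1\<close> moves out, and the remaining \<open>k\<close> of them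
    combine with \<open>(1 - 1 / real L) ^ k\<close> to \<open>x ^ k\<close>.\<close>
  have summand: "mean_detected_singletons L P\<^sub>M\<^sub>D (Suc k) * prob {\<omega> \<in> space M. K \<omega> = Suc k} =
      (1 - P\<^sub>M\<^sub>D) * \<beta>\<^sub>1 * exp (- \<beta>\<^sub>1) * (x ^ k / fact k)" for k
  proof -
    have "prob {\<omega> \<in> space M. K \<omega> = Suc k} = \<beta>\<^sub>1 ^ Suc k / fact (Suc k) * exp (- \<beta>\<^sub>1)"
      using active_users by (simp add: has_poisson_law_def)
    then show ?thesis
      using \<open>1 \<le> L\<close>
      by (simp add: mean_detected_singletons_def alpha1_def x_def power_mult_distrib
          fact_Suc divide_simps mult_ac del: of_nat_Suc)
  qed
  have 2: "K\<^sub>1 = (1 - P\<^sub>M\<^sub>D) * \<beta>\<^sub>1 * exp (- \<beta>\<^sub>1) * S"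
    by (simp only: 1 summand S_def sum_distrib_left)
  \<comment> \<open>Both the gamma quotient and the Poisson distribution function equal
    \<open>exp (- x) * S\<close>. Splitting off \<open>exp (- x)\<close> leaves the prefactor
    \<open>exp (- \<beta>\<^sub>1 / real L)\<close>.\<close>
  have "exp (- \<beta>\<^sub>1) = exp (- \<beta>\<^sub>1 / real L) * exp (- x)"
    by (simp add: x_def exp_add[symmetric] algebra_simps)
  with 2 have 3: "K\<^sub>1 = (1 - P\<^sub>M\<^sub>D) * \<beta>\<^sub>1 * exp (- \<beta>\<^sub>1 / real L) * (exp (- x) * S)"
    by simp
  have gamma: "upper_incomplete_gamma (N - 1) x / fact (N - 2) = exp (- x) * S"
    using upper_incomplete_gamma_Suc[OF x] by (simp add: m S_def)
  \<comment> \<open>Dividing by \<open>Z\<close> turns \<open>\<beta>\<^sub>1 = lam * Z\<close> into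
    \<open>lam\<close>.\<close>
  have 4: "\<eta>\<^sub>1 = lam * (1 - P\<^sub>M\<^sub>D) * exp (- \<beta>\<^sub>1 / real L) * (exp (- x) * S)"
    using 3 Zpos by (simp add: eta1 throughput_def beta)
  have "(\<Sum>k = 1..N - 1. mean_detected_singletons L P\<^sub>M\<^sub>D k * prob {\<omega> \<in> space M. K \<omega> = k}) =
      (\<Sum>k\<le>m. mean_detected_singletons L P\<^sub>M\<^sub>D (Suc k) * prob {\<omega> \<in> space M. K \<omega> = Suc k})"
    using sum.shift_bounds_cl_Suc_ivl[of _ 0 m] by (simp add: m atMost_atLeast0)
  with 1 have 5: "K\<^sub>1 = (\<Sum>k = 1..N - 1. mean_detected_singletons L P\<^sub>M\<^sub>D k * prob {\<omega> \<in> space M. K \<omega> = k})"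
    by simp
  show ?thesis
    unfolding x_def[symmetric] gamma
    using 2 3 4 5 by (auto simp: prob_space.poisson_le m S_def atMost_atLeast0)
qed

end
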